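(* Let $(S,+,\cdot)$ be a left semibrace with multiplicative identity $e$. Let $K=S+e=\{s+e: s\in S\}$ and let $R=E(e+S)$ be the set of idempotents of the semigroup $(e+S,+)$, where $e+S=\{e+s:s\in S\}$; with the restricted operations, $(K,+,\cdot)$ and $(R,+,\cdot)$ are left semibraces. For $a\in K$ and $x\in R$ put $$\delta_a(x)=(a+x^{-1})^{-1}a\in R,\qquad \sigma_x(a)=x(a+x^{-1})\in K,$$ and let $\delta:a\mapsto\delta_a$, $\sigma:x\mapsto\sigma_x$. Then the generalized matched product $K\bowtie^{\delta}_{\sigma}R$ of $K$ and $R$ by $\delta$ and $\sigma$ is defined, and $$(S,+,\cdot)\cong(K,+,\cdot)\bowtie^{\delta}_{\sigma}(R,+,\cdot)$$ as left semibraces.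
   Context: Multiplication has higher precedence than addition. A left semibrace is a triple $(S,+,\cdot)$ such that $(S,+)$ is a (not necessarily commutative) semigroup, $(S,\cdot)$ is a group, and $x(y+z)=xy+x(x^{-1}+z)$ for all $x,y,z\in S$, where $x^{-1}$ is the inverse of $x$ in $(S,\cdot)$. An isomorphism of left semibraces is a bijection preserving both $+$ and $\cdot$. Generalized matched product. Let $(K,+,\cdot)$ and $(R,+,\cdot)$ be left semibraces with multiplicative identities $e_K$ and $e_R$. Let $\delta:a\mapsto\delta_a$ be a right action of the group $(K,\cdot)$ on the set $R$ (each $\delta_a$ is a permutation of $R$ and $\delta_{ab}=\delta_b\circ\delta_a$), and let $\sigma:x\mapsto\sigma_x$ be a left action of the group $(R,\cdot)$ on the set $K$ (each $\sigma_x$ is a permutation of $K$ and $\sigma_{xy}=\sigma_x\circ\sigma_y$). Assume that for all $x,y\in R$ and $a,b,c\in K$: (a) $\sigma_x(ab)=\sigma_x(a)\,\sigma_{\delta_a(x)}(b)$; (b) $\sigma_x(e_K)=e_K$; (c) $\delta_a(xy)=\delta_{\sigma_y(a)}(x)\,\delta_a(y)$; (d) $\delta_a(e_R)=e_R$; (e) $(\delta_a((x+y)^{-1}))^{-1}=(\delta_a(x^{-1}))^{-1}+(\delta_a(y^{-1}))^{-1}$; (f) $a\cdot\sigma_{(\delta_a(x^{-1}))^{-1}}(b+c)=a\cdot\sigma_{(\delta_a(x^{-1}))^{-1}}(b)+a\cdot\sigma_{(\delta_a(x^{-1}))^{-1}}\bigl(\sigma_{\delta_a(x^{-1})}(a^{-1})+c\bigr)$.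 Then the set $K\times R$ is a left semibrace under the operations $$(a,x)+(b,y)=(a+b,\,x+y),$$ $$(a,x)(b,y)=\Bigl(a\cdot\sigma_{(\delta_a(x^{-1}))^{-1}}(b),\ x\cdot\bigl(\delta_{(\sigma_{x^{-1}}(a))^{-1}}(y^{-1})\bigr)^{-1}\Bigr).$$ This left semibrace is called the generalized matched product of $K$ and $R$ by $\delta$ and $\sigma$ and is denoted $K\bowtie^{\delta}_{\sigma}R$. *)

theory Defs
  imports "HOL-Algebra.Group"
begin

record 'a semibrace = "'a monoid" +
  sb_add :: "'a \<Rightarrow> 'a \<Rightarrow> 'a" (infixl \<open>\<boxplus>\<index>\<close> 65)

locale left_semibrace = group S for S :: "('a, 'm) semibrace_scheme" (structure) +
  assumes add_closed: "\<lbrakk>x \<in> carrier S; y \<in> carrier S\<rbrakk> \<Longrightarrow> x \<boxplus> y \<in> carrier S"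
    and add_assoc: "\<lbrakk>x \<in> carrier S; y \<in> carrier S; z \<in> carrier S\<rbrakk> \<Longrightarrow>
      (x \<boxplus> y) \<boxplus> z = x \<boxplus> (y \<boxplus> z)"
    and mult_add: "\<lbrakk>x \<in> carrier S; y \<in> carrier S; z \<in> carrier S\<rbrakk> \<Longrightarrow>
      x \<otimes> (y \<boxplus> z) = x \<otimes> y \<boxplus> x \<otimes> (inv x \<boxplus> z)"

definition semibrace_iso ::
  "('a, 'm) semibrace_scheme \<Rightarrow> ('b, 'n) semibrace_scheme \<Rightarrow> ('a \<Rightarrow> 'b) set"
  where "semibrace_iso S T =
    {h \<in> iso S T. \<forall>x\<in>carrier S. \<forall>y\<in>carrier S. h (x \<boxplus>\<^bsub>S\<^esub> y) = h x \<boxplus>\<^bsub>T\<^esub> h y}"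

definition semibrace_isomorphic ::
  "('a, 'm) semibrace_scheme \<Rightarrow> ('b, 'n) semibrace_scheme \<Rightarrow> bool"
  where "semibrace_isomorphic S T \<longleftrightarrow> semibrace_iso S T \<noteq> {}"

text \<open>The data of a generalized matched product: \<open>\<delta> a\<close> is \<open>\<delta>\<^sub>a\<close> and \<open>\<sigma> x\<close> is \<open>\<sigma>\<^sub>x\<close>.
  Only their values on the carriers are constrained.\<close>

locale generalized_matched_pair =
  K: left_semibrace K + R: left_semibrace R
  for K :: "('a, 'm) semibrace_scheme" (structure)
    and R :: "('b, 'n) semibrace_scheme" (structure)
    and \<delta> :: "'a \<Rightarrow> 'b \<Rightarrow> 'b"
    and \<sigma> :: "'b \<Rightarrow> 'a \<Rightarrow> 'a" +
  assumes delta_bij: "a \<in> carrier K \<Longrightarrow> bij_betw (\<delta> a) (carrier R) (carrier R)"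
    and delta_right_action: "\<lbrakk>a \<in> carrier K; b \<in> carrier K; x \<in> carrier R\<rbrakk> \<Longrightarrow>
      \<delta> (a \<otimes>\<^bsub>K\<^esub> b) x = \<delta> b (\<delta> a x)"
    and sigma_bij: "x \<in> carrier R \<Longrightarrow> bij_betw (\<sigma> x) (carrier K) (carrier K)"
    and sigma_left_action: "\<lbrakk>x \<in> carrier R; y \<in> carrier R; a \<in> carrier K\<rbrakk> \<Longrightarrow>
      \<sigma> (x \<otimes>\<^bsub>R\<^esub> y) a = \<sigma> x (\<sigma> y a)"
    and sigma_mult: "\<lbrakk>x \<in> carrier R; a \<in> carrier K; b \<in> carrier K\<rbrakk> \<Longrightarrow>
      \<sigma> x (a \<otimes>\<^bsub>K\<^esub> b) = \<sigma> x a \<otimes>\<^bsub>K\<^esub> \<sigma> (\<delta> a x) b"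
    and sigma_one: "x \<in> carrier R \<Longrightarrow> \<sigma> x \<one>\<^bsub>K\<^esub> = \<one>\<^bsub>K\<^esub>"
    and delta_mult: "\<lbrakk>a \<in> carrier K; x \<in> carrier R; y \<in> carrier R\<rbrakk> \<Longrightarrow>
      \<delta> a (x \<otimes>\<^bsub>R\<^esub> y) = \<delta> (\<sigma> y a) x \<otimes>\<^bsub>R\<^esub> \<delta> a y"
    and delta_one: "a \<in> carrier K \<Longrightarrow> \<delta> a \<one>\<^bsub>R\<^esub> = \<one>\<^bsub>R\<^esub>"
    and delta_add: "\<lbrakk>a \<in> carrier K; x \<in> carrier R; y \<in> carrier R\<rbrakk> \<Longrightarrow>
      inv\<^bsub>R\<^esub> \<delta> a (inv\<^bsub>R\<^esub> (x \<boxplus>\<^bsub>R\<^esub> y)) =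
        inv\<^bsub>R\<^esub> \<delta> a (inv\<^bsub>R\<^esub> x) \<boxplus>\<^bsub>R\<^esub> inv\<^bsub>R\<^esub> \<delta> a (inv\<^bsub>R\<^esub> y)"
    and sigma_add: "\<lbrakk>x \<in> carrier R; a \<in> carrier K; b \<in> carrier K; c \<in> carrier K\<rbrakk> \<Longrightarrow>
      a \<otimes>\<^bsub>K\<^esub> \<sigma> (inv\<^bsub>R\<^esub> \<delta> a (inv\<^bsub>R\<^esub> x)) (b \<boxplus>\<^bsub>K\<^esub> c) =
        a \<otimes>\<^bsub>K\<^esub> \<sigma> (inv\<^bsub>R\<^esub> \<delta> a (inv\<^bsub>R\<^esub> x)) b \<boxplus>\<^bsub>K\<^esub>
        a \<otimes>\<^bsub>K\<^esub> \<sigma> (inv\<^bsub>R\<^esub> \<delta> a (inv\<^bsub>R\<^esub> x)) (\<sigma> (\<delta> a (inv\<^bsub>R\<^esub> x)) (inv\<^bsub>K\<^esub> a) \<boxplus>\<^bsub>K\<^esub> c)"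

definition generalized_matched_product ::
  "('a, 'm) semibrace_scheme \<Rightarrow> ('b, 'n) semibrace_scheme \<Rightarrow>
    ('a \<Rightarrow> 'b \<Rightarrow> 'b) \<Rightarrow> ('b \<Rightarrow> 'a \<Rightarrow> 'a) \<Rightarrow> ('a \<times> 'b) semibrace"
  where "generalized_matched_product K R \<delta> \<sigma> =
    \<lparr>carrier = carrier K \<times> carrier R,
     mult = (\<lambda>(a, x) (b, y).
       (a \<otimes>\<^bsub>K\<^esub> \<sigma> (inv\<^bsub>R\<^esub> \<delta> a (inv\<^bsub>R\<^esub> x)) b,
        x \<otimes>\<^bsub>R\<^esub> inv\<^bsub>R\<^esub> \<delta> (inv\<^bsub>K\<^esub> \<sigma> (inv\<^bsub>R\<^esub> x) a) (inv\<^bsub>R\<^esub> y))),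
     one = (\<one>\<^bsub>K\<^esub>, \<one>\<^bsub>R\<^esub>),
     sb_add = (\<lambda>(a, x) (b, y). (a \<boxplus>\<^bsub>K\<^esub> b, x \<boxplus>\<^bsub>R\<^esub> y))\<rparr>"

definition K_part :: "('a, 'm) semibrace_scheme \<Rightarrow> ('a, 'm) semibrace_scheme"
  where "K_part S = S\<lparr>carrier := {s \<boxplus>\<^bsub>S\<^esub> \<one>\<^bsub>S\<^esub> | s. s \<in> carrier S}\<rparr>"

definition R_part :: "('a, 'm) semibrace_scheme \<Rightarrow> ('a, 'm) semibrace_scheme"
  where "R_part S =
    S\<lparr>carrier := {x \<in> {\<one>\<^bsub>S\<^esub> \<boxplus>\<^bsub>S\<^esub> s | s. s \<in> carrier S}. x \<boxplus>\<^bsub>S\<^esub> x = x}\<rparr>"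

definition delta :: "('a, 'm) semibrace_scheme \<Rightarrow> 'a \<Rightarrow> 'a \<Rightarrow> 'a"
  where "delta S a x = inv\<^bsub>S\<^esub> (a \<boxplus>\<^bsub>S\<^esub> inv\<^bsub>S\<^esub> x) \<otimes>\<^bsub>S\<^esub> a"

definition sigma :: "('a, 'm) semibrace_scheme \<Rightarrow> 'a \<Rightarrow> 'a \<Rightarrow> 'a"
  where "sigma S x a = x \<otimes>\<^bsub>S\<^esub> (a \<boxplus>\<^bsub>S\<^esub> inv\<^bsub>S\<^esub> x)"

end

theory Submission
  imports Defs
begin

text \<open>
  Write \<open>e\<close> for the multiplicative identity and \<open>\<lambda>\<^sub>x(z) = x(x\<^sup>-\<^sup>1 + z)\<close>, so that the semibrace law reads
  \<open>x(y + z) = xy + \<lambda>\<^sub>x(z)\<close>. The maps \<open>\<lambda>\<^sub>x\<close> are additive and \<open>\<lambda>\<^bsub>xy\<^esub> = \<lambda>\<^sub>x \<circ> \<lambda>\<^sub>y\<close>, but \<open>\<lambda>\<^sub>e\<close> is only the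
  projection \<open>z \<mapsto> e + z\<close>; hence \<open>\<lambda>\<close> is an action of the multiplicative group on \<open>e + S\<close>. The
  first point is that \<open>e + e = e\<close> (\<open>one_add_one\<close>). The element \<open>e\<close> is then a point of \<open>e + S\<close>, and everything follows by studying its orbit and its stabiliser:

  \<^item> the stabiliser of \<open>e\<close> is \<open>K = S + e\<close> (\<open>K_part_iff\<close>), which is therefore a subgroup;

  \<^item> the orbit of \<open>e\<close> is \<open>R = E(e + S)\<close>, which is also \<open>{x. x + e = e}\<close> (\<open>R_part_iff\<close>). It is a
    right zero band for \<open>+\<close>, so \<open>\<lambda>\<^sub>x(y) = xy\<close> for \<open>x\<close> and \<open>y\<close> in \<open>R\<close>: the set \<open>R\<close> is a subgroup acting on
    the orbit by left translation, that is, simply transitively.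

  A stabiliser and a subgroup that is simply transitive on the orbit are complements, so every \<open>s\<close>
  factors uniquely in \<open>K R\<close> and in \<open>R K\<close>. The \<open>K\<close>-factor in \<open>K R\<close> is \<open>s + e\<close> and the \<open>R\<close>-factor in
  \<open>R K\<close> is \<open>\<lambda>\<^sub>s(e)\<close> (\<open>KR_add_one\<close>, \<open>RK_lam_one\<close>). The given maps are those of this exact
  factorisation, being determined by \<open>xa = \<sigma>\<^sub>x(a) \<delta>\<^sub>a(x)\<close> (\<open>sigma_delta_unique\<close>). The
  multiplicative axioms of a matched pair express associativity of products such as \<open>xab\<close> and
  \<open>xya\<close>. The additive axiom for \<open>\<delta>\<close> is immediate in a right zero band, and the one for \<open>\<sigma>\<close> is the
  law \<open>s(b + c) = sb + \<lambda>\<^sub>s(c)\<close> with \<open>s = ay\<close>, followed by adding \<open>e\<close> on the right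
  (\<open>sigma_semibrace_law\<close>).

  The isomorphism is \<open>s \<mapsto> (s + e, \<lambda>\<^sub>s(e))\<close>. It mixes the two factorisations, and so does the
  multiplication of the generalized matched product. Its compatibility with addition rests on
  \<open>s + e + t = s + t\<close> (\<open>add_one_add\<close>) and \<open>\<lambda>\<^bsub>s + t\<^esub>(e) = \<lambda>\<^sub>t(e)\<close>. That the product is a left semibrace
  is then inherited from \<open>S\<close> along this bijection.
\<close>

section \<open>The lambda action\<close>

context left_semibrace
begin

definition lam :: "'a \<Rightarrow> 'a \<Rightarrow> 'a"
  where "lam x z = x \<otimes> (inv x \<boxplus> z)"

lemma lam_closed [simp]: "\<lbrakk>x \<in> carrier S; z \<in> carrier S\<rbrakk> \<Longrightarrow> lam x z \<in> carrier S"
  by (simp add: lam_def add_closed)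

lemma mult_add_lam:
  "\<lbrakk>x \<in> carrier S; y \<in> carrier S; z \<in> carrier S\<rbrakk> \<Longrightarrow> x \<otimes> (y \<boxplus> z) = x \<otimes> y \<boxplus> lam x z"
  unfolding lam_def by (rule mult_add)

lemma lam_unit: "z \<in> carrier S \<Longrightarrow> lam \<one> z = \<one> \<boxplus> z"
  by (simp add: lam_def add_closed)

lemma lam_mult:
  assumes "x \<in> carrier S" "y \<in> carrier S" "z \<in> carrier S"
  shows "lam (x \<otimes> y) z = lam x (lam y z)"
proof -
  have "y \<otimes> (inv y \<otimes> inv x \<boxplus> z) = inv x \<boxplus> lam y z"
    using assms by (simp add: mult_add_lam m_assoc [symmetric])
  then show ?thesis
    using assms by (simp add: lam_def [of "x \<otimes> y"] lam_def [of x] inv_mult_group m_assoc add_closed)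
qed

lemma lam_add:
  assumes "x \<in> carrier S" "y \<in> carrier S" "z \<in> carrier S"
  shows "lam x (y \<boxplus> z) = lam x y \<boxplus> lam x z"
  using assms mult_add_lam [of x "inv x \<boxplus> y" z]
  by (simp add: lam_def [of x "y \<boxplus> z"] lam_def [of x y] add_assoc add_closed)

lemma lam_one_add:
  assumes "x \<in> carrier S" "z \<in> carrier S"
  shows "lam x (\<one> \<boxplus> z) = lam x z"
  using lam_mult [of x \<one> z] assms by (simp add: lam_unit)

lemma one_add_lam:
  assumes "x \<in> carrier S" "z \<in> carrier S"
  shows "\<one> \<boxplus> lam x z = lam x z"
  using lam_mult [of \<one> x z] assms by (simp add: lam_unit)

lemma lam_inv_lam:
  assumes "x \<in> carrier S" "z \<in> carrier S"
  shows "lam (inv x) (lam x z) = \<one> \<boxplus> z" and "lam x (lam (inv x) z) = \<one> \<boxplus> z"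
  using lam_mult [of "inv x" x z] lam_mult [of x "inv x" z] assms by (simp_all add: lam_unit)

text \<open>
  Addition is recovered from multiplication and \<open>\<lambda>\<close>; this reduces identities about sums to the
  action.
\<close>

lemma add_eq_mult:
  assumes "x \<in> carrier S" "z \<in> carrier S"
  shows "x \<boxplus> z = x \<otimes> (\<one> \<boxplus> lam (inv x) z)"
proof -
  have "\<one> \<boxplus> lam (inv x) z = inv x \<otimes> (x \<boxplus> z)"
    using assms by (simp add: mult_add_lam)
  then show ?thesis
    using assms by (simp add: add_closed m_assoc [symmetric])
qed

text \<open>
  The summand \<open>e\<close> can be absorbed in the middle of any sum, because \<open>\<lambda>\<close> does not
  distinguish \<open>z\<close> from \<open>e + z\<close>.
\<close>

lemma add_one_add:
  assumes "x \<in> carrier S" "z \<in> carrier S"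
  shows "x \<boxplus> (\<one> \<boxplus> z) = x \<boxplus> z"
  using assms by (simp add: add_eq_mult [of x] lam_one_add add_closed)

text \<open>
  The element \<open>f = e + e\<close> is an additive idempotent with \<open>f + e = f\<close>. Expanding
  \<open>f\<^sup>-\<^sup>1(e + e)\<close> gives \<open>f\<^sup>-\<^sup>1 + e = e\<close>, hence \<open>\<lambda>\<^sub>f(e) = f\<close>. Expanding \<open>f(e + e)\<close> now shows that \<open>f\<close> is
  idempotent in the multiplicative group as well, so \<open>f = e\<close>.
\<close>

lemma one_add_one: "\<one> \<boxplus> \<one> = \<one>"
proof -
  define f where "f = \<one> \<boxplus> \<one>"
  have f: "f \<in> carrier S" by (simp add: f_def add_closed)
  have fe: "f \<boxplus> \<one> = f"
    by (simp add: f_def add_assoc add_one_add)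
  have ff: "f \<boxplus> f = f"
    using f fe unfolding f_def by (simp add: add_one_add add_closed)
  have "inv f \<otimes> (\<one> \<boxplus> \<one>) = inv f \<boxplus> lam (inv f) \<one>"
    using f by (simp add: mult_add_lam)
  moreover have "lam (inv f) \<one> = \<one>"
    using f fe by (simp add: lam_def)
  ultimately have "inv f \<boxplus> \<one> = \<one>"
    using f by (simp flip: f_def)
  then have "lam f \<one> = f"
    using f by (simp add: lam_def)
  then have "f \<otimes> f = f"
    using f ff mult_add_lam [of f \<one> \<one>] by (simp flip: f_def)
  then show ?thesis
    using f by (simp flip: f_def)
qed

text \<open>
  Among the elements of \<open>e + S\<close> there is exactly one right identity for \<open>u\<close>, and it is \<open>\<lambda>\<^sub>u(e)\<close>:
  dividing \<open>u + r = u\<close> by \<open>u\<close> turns it into \<open>\<lambda>\<^bsub>u\<^sup>-\<^sup>1\<^esub>(r) = e\<close>, and the action is invertible on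
  \<open>e + S\<close>. The case \<open>r = e\<close> identifies \<open>K\<close>, the case \<open>u = r\<close> identifies \<open>R\<close>.
\<close>

lemma add_eq_self_iff:
  assumes "u \<in> carrier S" "r \<in> carrier S" "\<one> \<boxplus> r = r"
  shows "u \<boxplus> r = u \<longleftrightarrow> lam u \<one> = r"
proof -
  have "u \<boxplus> r = u \<longleftrightarrow> lam (inv u) r = \<one>"
    using assms by (simp add: add_eq_mult [of u] one_add_lam)
  also have "\<dots> \<longleftrightarrow> lam u \<one> = r"
    using assms lam_inv_lam [of u r] lam_inv_lam [of u \<one>] one_add_one by auto
  finally show ?thesis .
qed

lemma add_lam_one: "u \<in> carrier S \<Longrightarrow> u \<boxplus> lam u \<one> = u"
  by (simp add: add_eq_self_iff one_add_lam)

text \<open>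
  The element \<open>e\<close> is a left identity of \<open>e + S\<close>, and the automorphism \<open>\<lambda>\<^sub>u\<close> of \<open>e + S\<close> carries it to
  another left identity, here applied to \<open>e = \<lambda>\<^sub>u(\<lambda>\<^bsub>u\<^sup>-\<^sup>1\<^esub>(e))\<close>.
\<close>

lemma lam_one_left_neutral:
  assumes "u \<in> carrier S"
  shows "lam u \<one> \<boxplus> \<one> = \<one>"
proof -
  have "lam u \<one> \<boxplus> \<one> = lam u (\<one> \<boxplus> lam (inv u) \<one>)"
    using assms by (simp add: lam_add lam_inv_lam one_add_one)
  also have "\<dots> = \<one>"
    using assms by (simp add: lam_one_add lam_inv_lam one_add_one)
  finally show ?thesis .
qed

section \<open>The two subgroups\<close>

lemma carrier_K_part: "carrier (K_part S) = {a \<in> carrier S. a \<boxplus> \<one> = a}"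
proof -
  have "s \<boxplus> \<one> \<boxplus> \<one> = s \<boxplus> \<one>" if "s \<in> carrier S" for s
    using that by (simp add: add_assoc one_add_one)
  then show ?thesis
    by (auto simp: K_part_def add_closed) metis
qed

lemma K_part_iff: "a \<in> carrier (K_part S) \<longleftrightarrow> a \<in> carrier S \<and> lam a \<one> = \<one>"
  by (auto simp: carrier_K_part add_eq_self_iff one_add_one)

lemma inv_add_one_iff:
  assumes "x \<in> carrier S"
  shows "inv x \<boxplus> \<one> = \<one> \<longleftrightarrow> lam x \<one> = x"
  using assms by (simp add: lam_def add_closed)

text \<open>
  By definition of \<open>\<lambda>\<close>, \<open>\<lambda>\<^sub>x(e) = x\<close> amounts to \<open>x\<^sup>-\<^sup>1 + e = e\<close>. It implies \<open>x + e = e\<close>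
  because \<open>\<lambda>\<^sub>x(e)\<close> is a left identity of \<open>e + S\<close>. The same applied to \<open>x\<^sup>-\<^sup>1\<close> gives the converse.
\<close>

lemma add_one_iff:
  assumes "x \<in> carrier S"
  shows "x \<boxplus> \<one> = \<one> \<longleftrightarrow> lam x \<one> = x"
proof
  assume "lam x \<one> = x"
  then show "x \<boxplus> \<one> = \<one>"
    using lam_one_left_neutral [OF assms] by simp
next
  assume "x \<boxplus> \<one> = \<one>"
  then have "lam (inv x) \<one> = inv x"
    using assms inv_add_one_iff [of "inv x"] by simp
  then have "inv x \<boxplus> \<one> = \<one>"
    using lam_one_left_neutral [of "inv x"] assms by simp
  then show "lam x \<one> = x"
    using assms by (simp add: inv_add_one_iff)
qed

text \<open>
  An idempotent \<open>x\<close> of \<open>e + S\<close> is a right identity for itself, so it equals \<open>\<lambda>\<^sub>x(e)\<close>. Thus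
  all idempotents of \<open>e + S\<close> are left identities.
\<close>

lemma R_part_iff: "x \<in> carrier (R_part S) \<longleftrightarrow> x \<in> carrier S \<and> x \<boxplus> \<one> = \<one>"
proof
  assume "x \<in> carrier (R_part S)"
  then obtain s where s: "s \<in> carrier S" "x = \<one> \<boxplus> s" and xx: "x \<boxplus> x = x"
    by (auto simp: R_part_def)
  then have x: "x \<in> carrier S" by (simp add: add_closed)
  have "\<one> \<boxplus> x = x"
    using s by (simp add: add_one_add)
  then have "lam x \<one> = x"
    using add_eq_self_iff [of x x] x xx by simp
  with x show "x \<in> carrier S \<and> x \<boxplus> \<one> = \<one>"
    by (simp add: add_one_iff)
next
  assume x: "x \<in> carrier S \<and> x \<boxplus> \<one> = \<one>"
  then have lx: "lam x \<one> = x" using add_one_iff by blast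
  then have "\<one> \<boxplus> x = x" "x \<boxplus> x = x"
    using x one_add_lam [of x \<one>] add_lam_one [of x] by simp_all
  then show "x \<in> carrier (R_part S)"
    using x by (auto simp: R_part_def) metis
qed

lemma K_part_closed: "a \<in> carrier (K_part S) \<Longrightarrow> a \<in> carrier S"
  by (simp add: K_part_iff)

lemma R_part_closed: "x \<in> carrier (R_part S) \<Longrightarrow> x \<in> carrier S"
  by (simp add: R_part_iff)

lemma lam_K_one: "a \<in> carrier (K_part S) \<Longrightarrow> lam a \<one> = \<one>"
  by (simp add: K_part_iff)

lemma lam_R_one: "x \<in> carrier (R_part S) \<Longrightarrow> lam x \<one> = x"
  using R_part_iff add_one_iff by blast

lemma R_part_add_one: "x \<in> carrier (R_part S) \<Longrightarrow> x \<boxplus> \<one> = \<one>"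
  by (simp add: R_part_iff)

lemma add_one_in_K: "s \<in> carrier S \<Longrightarrow> s \<boxplus> \<one> \<in> carrier (K_part S)"
  by (auto simp: K_part_def)

lemma lam_one_in_R: "s \<in> carrier S \<Longrightarrow> lam s \<one> \<in> carrier (R_part S)"
  by (simp add: R_part_iff lam_one_left_neutral)

lemma R_part_add:
  assumes "x \<in> carrier (R_part S)" "z \<in> carrier S"
  shows "x \<boxplus> z = \<one> \<boxplus> z"
proof -
  have "x \<boxplus> z = x \<boxplus> \<one> \<boxplus> z"
    using assms R_part_closed by (simp add: add_assoc add_one_add)
  then show ?thesis using assms by (simp add: R_part_add_one)
qed

lemma one_add_R_part: "x \<in> carrier (R_part S) \<Longrightarrow> \<one> \<boxplus> x = x"
  using one_add_lam [of x \<one>] by (simp add: R_part_closed lam_R_one)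

lemma R_part_right_zero:
  "\<lbrakk>x \<in> carrier (R_part S); y \<in> carrier (R_part S)\<rbrakk> \<Longrightarrow> x \<boxplus> y = y"
  by (simp add: R_part_add R_part_closed one_add_R_part)

lemma R_part_inv:
  assumes "x \<in> carrier (R_part S)" shows "inv x \<in> carrier (R_part S)"
  using assms by (auto simp: R_part_iff inv_add_one_iff add_one_iff [symmetric])

lemma lam_R_R:
  assumes "x \<in> carrier (R_part S)" "y \<in> carrier (R_part S)"
  shows "lam x y = x \<otimes> y"
  using assms by (simp add: lam_def R_part_right_zero R_part_inv)

lemma subgroup_K_part: "subgroup (carrier (K_part S)) S"
proof
  show "inv a \<in> carrier (K_part S)" if "a \<in> carrier (K_part S)" for a
    using that lam_inv_lam(1) [of a \<one>] by (auto simp: K_part_iff one_add_one)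
qed (auto simp: K_part_iff lam_mult lam_unit one_add_one)

lemma subgroup_R_part: "subgroup (carrier (R_part S)) S"
proof
  show "x \<otimes> y \<in> carrier (R_part S)"
    if "x \<in> carrier (R_part S)" "y \<in> carrier (R_part S)" for x y
    using lam_one_in_R [of "x \<otimes> y"] that by (simp add: R_part_closed lam_mult lam_R_one lam_R_R)
  show "\<one> \<in> carrier (R_part S)"
    by (simp add: R_part_iff one_add_one)
qed (auto simp: R_part_inv R_part_closed)

lemma K_part_one: "\<one> \<in> carrier (K_part S)"
  by (rule subgroup.one_closed [OF subgroup_K_part])

lemma K_part_inv: "a \<in> carrier (K_part S) \<Longrightarrow> inv a \<in> carrier (K_part S)"
  by (rule subgroup.m_inv_closed [OF subgroup_K_part])

lemma K_part_mult:
  "\<lbrakk>a \<in> carrier (K_part S); b \<in> carrier (K_part S)\<rbrakk> \<Longrightarrow> a \<otimes> b \<in> carrier (K_part S)"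
  by (rule subgroup.m_closed [OF subgroup_K_part])

lemma K_part_add:
  "\<lbrakk>a \<in> carrier (K_part S); b \<in> carrier (K_part S)\<rbrakk> \<Longrightarrow> a \<boxplus> b \<in> carrier (K_part S)"
  by (simp add: carrier_K_part add_closed add_assoc)

lemma R_part_one: "\<one> \<in> carrier (R_part S)"
  by (rule subgroup.one_closed [OF subgroup_R_part])

lemma R_part_mult:
  "\<lbrakk>x \<in> carrier (R_part S); y \<in> carrier (R_part S)\<rbrakk> \<Longrightarrow> x \<otimes> y \<in> carrier (R_part S)"
  by (rule subgroup.m_closed [OF subgroup_R_part])

text \<open>
  The law relating \<open>+\<close> and \<open>\<cdot>\<close> involves inverses, so it restricts to an additively closed subset
  as soon as this is a subgroup.
\<close>

lemma sub_semibrace: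
  assumes H: "subgroup H S"
    and add: "\<And>x y. \<lbrakk>x \<in> H; y \<in> H\<rbrakk> \<Longrightarrow> x \<boxplus> y \<in> H"
  shows "left_semibrace (S\<lparr>carrier := H\<rparr>)"
proof -
  have sub: "\<And>x. x \<in> H \<Longrightarrow> x \<in> carrier S"
    using subgroup.subset [OF H] by auto
  interpret H: group "S\<lparr>carrier := H\<rparr>"
    by (rule subgroup.subgroup_is_group [OF H is_group])
  show ?thesis
  proof unfold_locales
    fix x y z
    assume "x \<in> carrier (S\<lparr>carrier := H\<rparr>)" "y \<in> carrier (S\<lparr>carrier := H\<rparr>)"
      "z \<in> carrier (S\<lparr>carrier := H\<rparr>)"
    then show "x \<otimes>\<^bsub>S\<lparr>carrier := H\<rparr>\<^esub> (y \<boxplus>\<^bsub>S\<lparr>carrier := H\<rparr>\<^esub> z) =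
        x \<otimes>\<^bsub>S\<lparr>carrier := H\<rparr>\<^esub> y \<boxplus>\<^bsub>S\<lparr>carrier := H\<rparr>\<^esub>
        x \<otimes>\<^bsub>S\<lparr>carrier := H\<rparr>\<^esub> (inv\<^bsub>S\<lparr>carrier := H\<rparr>\<^esub> x \<boxplus>\<^bsub>S\<lparr>carrier := H\<rparr>\<^esub> z)"
      using mult_add [of x y z] by (simp add: sub m_inv_consistent [OF H])
  qed (simp_all add: add add_assoc sub)
qed

lemma K_part_eq: "K_part S = S\<lparr>carrier := carrier (K_part S)\<rparr>"
  by (simp add: K_part_def)

lemma R_part_eq: "R_part S = S\<lparr>carrier := carrier (R_part S)\<rparr>"
  by (simp add: R_part_def)

lemma left_semibrace_K_part: "left_semibrace (K_part S)"
  using sub_semibrace [OF subgroup_K_part K_part_add] by (simp flip: K_part_eq)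

lemma left_semibrace_R_part: "left_semibrace (R_part S)"
  using sub_semibrace [OF subgroup_R_part] by (simp add: R_part_right_zero flip: R_part_eq)

lemma K_part_ops [simp]:
  "x \<otimes>\<^bsub>K_part S\<^esub> y = x \<otimes> y" "\<one>\<^bsub>K_part S\<^esub> = \<one>" "x \<boxplus>\<^bsub>K_part S\<^esub> y = x \<boxplus> y"
  by (simp_all add: K_part_def)

lemma R_part_ops [simp]:
  "x \<otimes>\<^bsub>R_part S\<^esub> y = x \<otimes> y" "\<one>\<^bsub>R_part S\<^esub> = \<one>" "x \<boxplus>\<^bsub>R_part S\<^esub> y = x \<boxplus> y"
  by (simp_all add: R_part_def)

lemma K_part_m_inv [simp]: "a \<in> carrier (K_part S) \<Longrightarrow> inv\<^bsub>K_part S\<^esub> a = inv a"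
  using m_inv_consistent [OF subgroup_K_part, of a] by (simp flip: K_part_eq)

lemma R_part_m_inv [simp]: "x \<in> carrier (R_part S) \<Longrightarrow> inv\<^bsub>R_part S\<^esub> x = inv x"
  using m_inv_consistent [OF subgroup_R_part, of x] by (simp flip: R_part_eq)

section \<open>The exact factorisation and its matched pair\<close>

text \<open>
  The factors in \<open>K R\<close> and in \<open>R K\<close> are read off by \<open>s \<mapsto> s + e\<close> and \<open>s \<mapsto> \<lambda>\<^sub>s(e)\<close>
  respectively. In particular both factorisations are unique.
\<close>

lemma KR_add_one:
  assumes "a \<in> carrier (K_part S)" "y \<in> carrier (R_part S)"
  shows "a \<otimes> y \<boxplus> \<one> = a"
proof -
  have "a \<otimes> (y \<boxplus> \<one>) = a \<otimes> y \<boxplus> lam a \<one>"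
    using assms by (simp add: mult_add_lam K_part_closed R_part_closed)
  then show ?thesis
    using assms by (simp add: R_part_add_one lam_K_one K_part_closed)
qed

lemma RK_lam_one:
  assumes "x \<in> carrier (R_part S)" "c \<in> carrier (K_part S)"
  shows "lam (x \<otimes> c) \<one> = x"
  using assms by (simp add: lam_mult lam_K_one lam_R_one K_part_closed R_part_closed)

lemma sigma_eq:
  assumes "x \<in> carrier (R_part S)" "a \<in> carrier S"
  shows "sigma S x a = x \<otimes> a \<boxplus> \<one>"
proof -
  have "x \<otimes> (a \<boxplus> inv x) = x \<otimes> a \<boxplus> lam x (inv x)"
    using assms by (simp add: mult_add_lam R_part_closed)
  then show ?thesis
    using assms by (simp add: sigma_def lam_R_R R_part_inv R_part_closed)
qed

lemma sigma_mult_delta: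
  assumes "x \<in> carrier (R_part S)" "a \<in> carrier S"
  shows "sigma S x a \<otimes> delta S a x = x \<otimes> a"
proof -
  have x: "x \<in> carrier S" using assms by (simp add: R_part_closed)
  define u where "u = a \<boxplus> inv x"
  have "u \<in> carrier S" using assms x by (simp add: u_def add_closed)
  then have "x \<otimes> u \<otimes> (inv u \<otimes> a) = x \<otimes> a"
    using assms x by (simp add: m_assoc [symmetric]) (simp add: m_assoc)
  then show ?thesis
    by (simp add: sigma_def delta_def u_def)
qed

lemma sigma_in_K:
  "\<lbrakk>x \<in> carrier (R_part S); a \<in> carrier S\<rbrakk> \<Longrightarrow> sigma S x a \<in> carrier (K_part S)"
  by (simp add: sigma_eq add_one_in_K R_part_closed)

text \<open>
  The quotient of \<open>s + e\<close> by \<open>s\<close> is \<open>s\<^sup>-\<^sup>1(s + e) = \<lambda>\<^bsub>s\<^sup>-\<^sup>1\<^esub>(e)\<close>, a point of the orbit of \<open>e\<close>. This is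
  the existence half of \<open>S = K R\<close>.
\<close>

lemma inv_add_one_mult_in_R:
  assumes "s \<in> carrier S"
  shows "inv (s \<boxplus> \<one>) \<otimes> s \<in> carrier (R_part S)"
proof -
  have "inv s \<otimes> (s \<boxplus> \<one>) = lam (inv s) \<one>"
    using assms by (simp add: mult_add_lam one_add_lam)
  then have "inv (inv s \<otimes> (s \<boxplus> \<one>)) \<in> carrier (R_part S)"
    using assms by (simp add: R_part_inv lam_one_in_R)
  then show ?thesis
    using assms by (simp add: inv_mult_group add_closed)
qed

lemma delta_eq:
  assumes "x \<in> carrier (R_part S)" "a \<in> carrier S"
  shows "delta S a x = inv (x \<otimes> a \<boxplus> \<one>) \<otimes> (x \<otimes> a)"
proof -
  have x: "x \<in> carrier S" using assms by (simp add: R_part_closed)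
  have "delta S a x \<in> carrier S"
    using assms x by (simp add: delta_def add_closed)
  then show ?thesis
    using sigma_mult_delta [OF assms] assms x
    by (simp add: sigma_eq inv_solve_left add_closed)
qed

lemma delta_in_R:
  "\<lbrakk>x \<in> carrier (R_part S); a \<in> carrier S\<rbrakk> \<Longrightarrow> delta S a x \<in> carrier (R_part S)"
  by (simp add: delta_eq inv_add_one_mult_in_R R_part_closed)

text \<open>
  The characterisation from which all the multiplicative identities for \<open>\<sigma>\<close> and \<open>\<delta>\<close> are
  derived: to compute them, exhibit a factorisation of \<open>xa\<close> in \<open>K R\<close>.
\<close>

lemma sigma_delta_unique:
  assumes "x \<in> carrier (R_part S)" "a \<in> carrier S"
    and "b \<in> carrier (K_part S)" "y \<in> carrier (R_part S)"
    and "x \<otimes> a = b \<otimes> y"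
  shows "sigma S x a = b" and "delta S a x = y"
proof -
  show s: "sigma S x a = b"
    using assms by (simp add: sigma_eq KR_add_one)
  show "delta S a x = y"
    using sigma_mult_delta [OF assms(1,2)] delta_in_R [OF assms(1,2)] assms
    by (simp add: s K_part_closed R_part_closed)
qed

lemma
  assumes "x \<in> carrier (R_part S)" "a \<in> carrier (K_part S)" "b \<in> carrier (K_part S)"
  shows sigma_mult_right: "sigma S x (a \<otimes> b) = sigma S x a \<otimes> sigma S (delta S a x) b"
    and delta_mult_left: "delta S (a \<otimes> b) x = delta S b (delta S a x)"
proof -
  let ?d = "delta S a x"
  have R: "?d \<in> carrier (R_part S)" "delta S b ?d \<in> carrier (R_part S)"
    and K: "sigma S x a \<in> carrier (K_part S)" "sigma S ?d b \<in> carrier (K_part S)"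
    using assms by (simp_all add: sigma_in_K delta_in_R K_part_closed)
  note cl = R [THEN R_part_closed] K [THEN K_part_closed]
    assms(1) [THEN R_part_closed] assms(2,3) [THEN K_part_closed]
  have "x \<otimes> (a \<otimes> b) = sigma S x a \<otimes> ?d \<otimes> b"
    using assms(1) cl by (simp only: sigma_mult_delta m_assoc)
  also have "\<dots> = sigma S x a \<otimes> (sigma S ?d b \<otimes> delta S b ?d)"
    using R(1) cl by (simp add: sigma_mult_delta m_assoc)
  finally have "x \<otimes> (a \<otimes> b) = sigma S x a \<otimes> sigma S ?d b \<otimes> delta S b ?d"
    using cl by (simp add: m_assoc)
  from sigma_delta_unique [OF assms(1) _ K_part_mult [OF K] R(2) this] cl
  show "sigma S x (a \<otimes> b) = sigma S x a \<otimes> sigma S ?d b"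
    and "delta S (a \<otimes> b) x = delta S b ?d"
    by simp_all
qed

lemma
  assumes "x \<in> carrier (R_part S)" "y \<in> carrier (R_part S)" "a \<in> carrier (K_part S)"
  shows sigma_mult_left: "sigma S (x \<otimes> y) a = sigma S x (sigma S y a)"
    and delta_mult_right: "delta S a (x \<otimes> y) = delta S (sigma S y a) x \<otimes> delta S a y"
proof -
  let ?c = "sigma S y a"
  have R: "delta S ?c x \<in> carrier (R_part S)" "delta S a y \<in> carrier (R_part S)"
    and K: "?c \<in> carrier (K_part S)" "sigma S x ?c \<in> carrier (K_part S)"
    using assms by (simp_all add: sigma_in_K delta_in_R K_part_closed)
  note cl = R [THEN R_part_closed] K [THEN K_part_closed]
    assms(1,2) [THEN R_part_closed] assms(3) [THEN K_part_closed]
  have "x \<otimes> y \<otimes> a = x \<otimes> ?c \<otimes> delta S a y"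
    using assms(2) cl by (simp add: sigma_mult_delta m_assoc)
  also have "\<dots> = sigma S x ?c \<otimes> delta S ?c x \<otimes> delta S a y"
    using assms(1) cl by (simp add: sigma_mult_delta)
  finally have "x \<otimes> y \<otimes> a = sigma S x ?c \<otimes> (delta S ?c x \<otimes> delta S a y)"
    using cl by (simp add: m_assoc)
  from sigma_delta_unique [OF R_part_mult [OF assms(1,2)] _ K(2) R_part_mult [OF R] this] cl
  show "sigma S (x \<otimes> y) a = sigma S x ?c"
    and "delta S a (x \<otimes> y) = delta S ?c x \<otimes> delta S a y"
    by simp_all
qed

lemma
  assumes "x \<in> carrier (R_part S)"
  shows sigma_on_one: "sigma S x \<one> = \<one>" and delta_of_one: "delta S \<one> x = x"
  using sigma_delta_unique [of x \<one> \<one> x] assms by (simp_all add: K_part_one R_part_closed)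

lemma
  assumes "a \<in> carrier (K_part S)"
  shows sigma_of_one: "sigma S \<one> a = a" and delta_on_one: "delta S a \<one> = \<one>"
  using sigma_delta_unique [of \<one> a a \<one>] assms by (simp_all add: R_part_one K_part_closed)

lemma delta_bij:
  assumes a: "a \<in> carrier (K_part S)"
  shows "bij_betw (delta S a) (carrier (R_part S)) (carrier (R_part S))"
proof (rule bij_betw_byWitness [where f' = "delta S (inv a)"])
  show "\<forall>x\<in>carrier (R_part S). delta S (inv a) (delta S a x) = x"
    "\<forall>x\<in>carrier (R_part S). delta S a (delta S (inv a) x) = x"
    using a by (simp_all add: delta_mult_left [symmetric] K_part_inv K_part_closed delta_of_one)
qed (use a in \<open>auto simp: delta_in_R K_part_inv K_part_closed\<close>)

lemma sigma_bij:
  assumes x: "x \<in> carrier (R_part S)"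
  shows "bij_betw (sigma S x) (carrier (K_part S)) (carrier (K_part S))"
proof (rule bij_betw_byWitness [where f' = "sigma S (inv x)"])
  show "\<forall>a\<in>carrier (K_part S). sigma S (inv x) (sigma S x a) = a"
    "\<forall>a\<in>carrier (K_part S). sigma S x (sigma S (inv x) a) = a"
    using x by (simp_all add: sigma_mult_left [symmetric] R_part_inv R_part_closed sigma_of_one)
qed (use x in \<open>auto simp: sigma_in_K R_part_inv K_part_closed\<close>)

text \<open>
  Both sides are the \<open>K\<close>-factor of \<open>ayb\<close>: left multiplication by an element of \<open>K\<close> commutes with
  adding \<open>e\<close> on the right, because \<open>K\<close> stabilises \<open>e\<close>.
\<close>

lemma K_mult_sigma:
  assumes "a \<in> carrier (K_part S)" "y \<in> carrier (R_part S)" "b \<in> carrier S"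
  shows "a \<otimes> sigma S y b = a \<otimes> y \<otimes> b \<boxplus> \<one>"
proof -
  have "a \<otimes> (y \<otimes> b \<boxplus> \<one>) = a \<otimes> (y \<otimes> b) \<boxplus> lam a \<one>"
    using assms by (simp add: mult_add_lam K_part_closed R_part_closed)
  then show ?thesis
    using assms by (simp add: sigma_eq lam_K_one m_assoc K_part_closed R_part_closed)
qed

text \<open>
  With \<open>s = ay\<close> one has \<open>\<sigma>\<^bsub>y\<^sup>-\<^sup>1\<^esub>(a\<^sup>-\<^sup>1) = s\<^sup>-\<^sup>1 + e\<close>, and the identity becomes
  \<open>s(b + c) + e = (sb + e) + (\<lambda>\<^sub>s(c) + e)\<close>.
\<close>

lemma sigma_semibrace_law:
  assumes a: "a \<in> carrier (K_part S)" and y: "y \<in> carrier (R_part S)"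
    and b: "b \<in> carrier S" and c: "c \<in> carrier S"
  shows "a \<otimes> sigma S y (b \<boxplus> c) =
    a \<otimes> sigma S y b \<boxplus> a \<otimes> sigma S y (sigma S (inv y) (inv a) \<boxplus> c)"
proof -
  define s where "s = a \<otimes> y"
  have s: "s \<in> carrier S" using a y by (simp add: s_def K_part_closed R_part_closed)
  have inv_s: "sigma S (inv y) (inv a) = inv s \<boxplus> \<one>"
    using a y by (simp add: s_def sigma_eq R_part_inv inv_mult_group K_part_closed R_part_closed)
  have lam: "s \<otimes> (inv s \<boxplus> \<one> \<boxplus> c) = lam s c"
    using s c by (simp add: add_assoc add_one_add lam_def)
  have "a \<otimes> sigma S y b \<boxplus> a \<otimes> sigma S y (sigma S (inv y) (inv a) \<boxplus> c) =
      (s \<otimes> b \<boxplus> \<one>) \<boxplus> (lam s c \<boxplus> \<one>)"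
    using a y b c s by (simp add: K_mult_sigma inv_s lam add_closed flip: s_def)
  also have "\<dots> = s \<otimes> b \<boxplus> lam s c \<boxplus> \<one>"
    using b c s by (simp add: add_assoc add_one_add add_closed)
  also have "\<dots> = a \<otimes> sigma S y (b \<boxplus> c)"
    using a y b c s by (simp add: K_mult_sigma mult_add_lam add_closed flip: s_def)
  finally show ?thesis ..
qed

lemma generalized_matched_pair_parts:
  "generalized_matched_pair (K_part S) (R_part S) (delta S) (sigma S)"
proof -
  interpret K: left_semibrace "K_part S" by (rule left_semibrace_K_part)
  interpret R: left_semibrace "R_part S" by (rule left_semibrace_R_part)
  note cl = sigma_in_K delta_in_R K_part_closed R_part_closed R_part_inv K_part_inv
  show ?thesis
  proof unfold_locales
    fix a x y
    assume "a \<in> carrier (K_part S)" "x \<in> carrier (R_part S)" "y \<in> carrier (R_part S)"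
    \<comment> \<open>In a right zero band both sides reduce to the term with \<open>y\<close>.\<close>
    then show "inv\<^bsub>R_part S\<^esub> delta S a (inv\<^bsub>R_part S\<^esub> (x \<boxplus>\<^bsub>R_part S\<^esub> y)) =
      inv\<^bsub>R_part S\<^esub> delta S a (inv\<^bsub>R_part S\<^esub> x) \<boxplus>\<^bsub>R_part S\<^esub>
      inv\<^bsub>R_part S\<^esub> delta S a (inv\<^bsub>R_part S\<^esub> y)"
      using cl by (simp add: R_part_right_zero)
  next
    fix x a b c
    assume *: "x \<in> carrier (R_part S)" "a \<in> carrier (K_part S)"
      "b \<in> carrier (K_part S)" "c \<in> carrier (K_part S)"
    let ?d = "delta S a (inv x)"
    have "?d \<in> carrier (R_part S)" using * cl by simp
    then show "a \<otimes>\<^bsub>K_part S\<^esub> sigma S (inv\<^bsub>R_part S\<^esub> delta S a (inv\<^bsub>R_part S\<^esub> x)) (b \<boxplus>\<^bsub>K_part S\<^esub> c) =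
      a \<otimes>\<^bsub>K_part S\<^esub> sigma S (inv\<^bsub>R_part S\<^esub> delta S a (inv\<^bsub>R_part S\<^esub> x)) b \<boxplus>\<^bsub>K_part S\<^esub>
      a \<otimes>\<^bsub>K_part S\<^esub> sigma S (inv\<^bsub>R_part S\<^esub> delta S a (inv\<^bsub>R_part S\<^esub> x))
        (sigma S (delta S a (inv\<^bsub>R_part S\<^esub> x)) (inv\<^bsub>K_part S\<^esub> a) \<boxplus>\<^bsub>K_part S\<^esub> c)"
      using * cl sigma_semibrace_law [of a "inv ?d" b c] by simp
  qed (simp_all add: delta_bij sigma_bij sigma_mult_right delta_mult_left sigma_mult_left
      delta_mult_right sigma_on_one delta_on_one)
qed

section \<open>The isomorphism\<close>

abbreviation matched_product :: "('a \<times> 'a) semibrace"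
  where "matched_product \<equiv>
    generalized_matched_product (K_part S) (R_part S) (delta S) (sigma S)"

text \<open>
  The first coordinate is the left factor in \<open>S = K R\<close>, the second the left factor in
  \<open>S = R K\<close>.
\<close>

definition coords :: "'a \<Rightarrow> 'a \<times> 'a"
  where "coords s = (s \<boxplus> \<one>, lam s \<one>)"

text \<open>
  If \<open>s = ay = xc\<close> are the two factorisations of \<open>s\<close>, then \<open>x\<^sup>-\<^sup>1a = cy\<^sup>-\<^sup>1\<close>, so the missing factors
  \<open>c\<close> and \<open>y\<close> are expressed through \<open>\<sigma>\<close> and \<open>\<delta>\<close>. This is the origin of the expressions
  \<open>(\<delta>\<^sub>a(x\<^sup>-\<^sup>1))\<^sup>-\<^sup>1\<close> and \<open>\<sigma>\<^bsub>x\<^sup>-\<^sup>1\<^esub>(a)\<close> in the multiplication of the generalized matched product.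
\<close>

lemma factorise:
  assumes s: "s \<in> carrier S" and a: "a = s \<boxplus> \<one>" and x: "x = lam s \<one>"
  shows "s = a \<otimes> inv (delta S a (inv x))" and "s = x \<otimes> sigma S (inv x) a"
proof -
  have aS: "a \<in> carrier S" and xR: "x \<in> carrier (R_part S)" and xS: "x \<in> carrier S"
    using assms by (simp_all add: lam_one_in_R add_closed)
  \<comment> \<open>The right factor in \<open>R K\<close> is the inverse of the left factor of \<open>s\<^sup>-\<^sup>1\<close> in \<open>K R\<close>.\<close>
  have "inv (inv s \<boxplus> \<one>) = inv x \<otimes> s"
    using s by (simp add: x lam_def inv_mult_group add_closed m_assoc)
  then have c: "inv x \<otimes> s \<in> carrier (K_part S)"
    using s K_part_inv [OF add_one_in_K, of "inv s"] by simp
  have y: "inv (inv a \<otimes> s) \<in> carrier (R_part S)"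
    using s by (simp add: a inv_add_one_mult_in_R R_part_inv)
  have "s \<otimes> inv (inv a \<otimes> s) = a"
    using s aS by (simp add: inv_mult_group m_assoc [symmetric])
  then have "inv x \<otimes> a = inv x \<otimes> s \<otimes> inv (inv a \<otimes> s)"
    using s aS xS by (simp add: m_assoc)
  from sigma_delta_unique [OF R_part_inv [OF xR] aS c y this]
  show "s = a \<otimes> inv (delta S a (inv x))" "s = x \<otimes> sigma S (inv x) a"
    using s aS xS by (simp_all add: m_assoc [symmetric])
qed

text \<open>
  Conversely, arbitrary \<open>a\<close> and \<open>x\<close> occur together: the element below has the left factor \<open>a\<close>
  in \<open>K R\<close> and the left factor \<open>x\<close> in \<open>R K\<close>. This makes \<open>coords\<close> surjective.
\<close>

lemma K_delta_eq_R_sigma: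
  assumes "a \<in> carrier (K_part S)" "x \<in> carrier (R_part S)"
  shows "a \<otimes> inv (delta S a (inv x)) = x \<otimes> sigma S (inv x) a"
proof -
  let ?d = "delta S a (inv x)" and ?c = "sigma S (inv x) a"
  have cl: "?d \<in> carrier S" "?c \<in> carrier S" "a \<in> carrier S" "x \<in> carrier S"
    using assms by (simp_all add: R_part_closed K_part_closed delta_in_R sigma_in_K R_part_inv)
  have "?c \<otimes> ?d = inv x \<otimes> a"
    using assms cl by (simp add: sigma_mult_delta R_part_inv)
  then have "x \<otimes> ?c \<otimes> ?d = a"
    using cl by (simp add: m_assoc) (simp add: m_assoc [symmetric])
  then show ?thesis
    using cl by (simp add: inv_solve_right')
qed

lemma coords_bij: "bij_betw coords (carrier S) (carrier (K_part S) \<times> carrier (R_part S))"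
proof (rule bij_betw_byWitness [where f' = "\<lambda>(a, x). a \<otimes> inv (delta S a (inv x))"])
  show "\<forall>s\<in>carrier S. (case coords s of (a, x) \<Rightarrow> a \<otimes> inv (delta S a (inv x))) = s"
    using factorise(1) by (auto simp: coords_def)
  show "\<forall>p\<in>carrier (K_part S) \<times> carrier (R_part S).
      coords (case p of (a, x) \<Rightarrow> a \<otimes> inv (delta S a (inv x))) = p"
  proof clarify
    fix a x assume *: "a \<in> carrier (K_part S)" "x \<in> carrier (R_part S)"
    then have "a \<otimes> inv (delta S a (inv x)) \<boxplus> \<one> = a"
      by (simp add: KR_add_one R_part_inv delta_in_R K_part_closed)
    moreover have "lam (a \<otimes> inv (delta S a (inv x))) \<one> = x"
      using * by (simp add: K_delta_eq_R_sigma RK_lam_one sigma_in_K R_part_inv K_part_closed)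
    ultimately show "coords (a \<otimes> inv (delta S a (inv x))) = (a, x)"
      by (simp add: coords_def)
  qed
qed (auto simp: coords_def add_one_in_K lam_one_in_R delta_in_R R_part_inv K_part_closed R_part_closed)

text \<open>
  Both sides are the left factor of \<open>cx\<close> in \<open>R K\<close>, the right one being found by inverting
  \<open>x\<^sup>-\<^sup>1c\<^sup>-\<^sup>1 = \<sigma>\<^bsub>x\<^sup>-\<^sup>1\<^esub>(c\<^sup>-\<^sup>1) \<delta>\<^bsub>c\<^sup>-\<^sup>1\<^esub>(x\<^sup>-\<^sup>1)\<close>.
\<close>

lemma lam_K_R:
  assumes c: "c \<in> carrier (K_part S)" and x: "x \<in> carrier (R_part S)"
  shows "lam c x = inv (delta S (inv c) (inv x))"
proof -
  let ?d = "delta S (inv c) (inv x)" and ?b = "sigma S (inv x) (inv c)"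
  have cS: "c \<in> carrier S" and xS: "x \<in> carrier S"
    using c x by (simp_all add: K_part_closed R_part_closed)
  then have d: "?d \<in> carrier (R_part S)" and b: "?b \<in> carrier (K_part S)"
    using x by (simp_all add: delta_in_R sigma_in_K R_part_inv)
  have "c \<otimes> x = inv (inv x \<otimes> inv c)"
    using cS xS by (simp add: inv_mult_group)
  also have "\<dots> = inv (?b \<otimes> ?d)"
    using cS x by (simp add: sigma_mult_delta R_part_inv)
  also have "\<dots> = inv ?d \<otimes> inv ?b"
    using b [THEN K_part_closed] d [THEN R_part_closed] by (simp add: inv_mult_group)
  finally have "lam (c \<otimes> x) \<one> = inv ?d"
    by (simp add: RK_lam_one R_part_inv [OF d] K_part_inv [OF b])
  then show ?thesis
    using cS xS x by (simp add: lam_mult lam_R_one)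
qed

text \<open>
  Let \<open>s = ad\<^sup>-\<^sup>1 = xc\<close> be the two factorisations of \<open>s\<close>. The \<open>K\<close>-coordinate of \<open>st\<close> is computed
  from the first as the \<open>K\<close>-factor of \<open>ad\<^sup>-\<^sup>1t\<close>, and the
  \<open>R\<close>-coordinate from \<open>\<lambda>\<^sub>s = \<lambda>\<^sub>x \<circ> \<lambda>\<^sub>c\<close>.
\<close>

lemma coords_mult:
  assumes s: "s \<in> carrier S" and t: "t \<in> carrier S"
  shows "coords (s \<otimes> t) = coords s \<otimes>\<^bsub>matched_product\<^esub> coords t"
proof -
  define a where "a = s \<boxplus> \<one>"
  define x where "x = lam s \<one>"
  define b where "b = t \<boxplus> \<one>"
  define y where "y = lam t \<one>"
  define c where "c = sigma S (inv x) a"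
  define d where "d = delta S a (inv x)"
  have a: "a \<in> carrier (K_part S)" and b: "b \<in> carrier (K_part S)"
    and x: "x \<in> carrier (R_part S)" and y: "y \<in> carrier (R_part S)"
    using s t by (simp_all add: a_def b_def x_def y_def add_one_in_K lam_one_in_R)
  have c: "c \<in> carrier (K_part S)" and d: "d \<in> carrier (R_part S)"
    using a x by (simp_all add: c_def d_def sigma_in_K delta_in_R R_part_inv K_part_closed)
  note s_eq = factorise [OF s a_def x_def, folded c_def d_def]
  have "a \<otimes> sigma S (inv d) b = s \<otimes> b \<boxplus> \<one>"
    using K_mult_sigma [OF a R_part_inv [OF d] K_part_closed [OF b]] by (simp flip: s_eq(1))
  also have "\<dots> = s \<otimes> t \<boxplus> (lam s \<one> \<boxplus> \<one>)"
    using s t by (simp add: b_def mult_add_lam add_assoc)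
  also have "\<dots> = s \<otimes> t \<boxplus> \<one>"
    using s by (simp add: lam_one_left_neutral)
  finally have 1: "s \<otimes> t \<boxplus> \<one> = a \<otimes> sigma S (inv d) b" ..
  have e: "delta S (inv c) (inv y) \<in> carrier (R_part S)"
    using c y by (simp add: delta_in_R R_part_inv K_part_closed)
  have "lam (s \<otimes> t) \<one> = lam (x \<otimes> c) y"
    using s t by (simp add: lam_mult y_def flip: s_eq(2))
  also have "\<dots> = lam x (lam c y)"
    using x y c by (simp add: lam_mult R_part_closed K_part_closed)
  also have "\<dots> = x \<otimes> inv (delta S (inv c) (inv y))"
    using c y by (simp add: lam_K_R lam_R_R [OF x R_part_inv [OF e]])
  finally have 2: "lam (s \<otimes> t) \<one> = x \<otimes> inv (delta S (inv c) (inv y))" .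
  have "coords s = (a, x)" "coords t = (b, y)"
    by (simp_all add: coords_def a_def x_def b_def y_def)
  then show ?thesis
    using a x y c d e 1 2
    by (simp add: coords_def generalized_matched_product_def R_part_inv flip: c_def d_def)
qed

text \<open>
  The \<open>R\<close>-coordinate of \<open>s + t\<close> is that of \<open>t\<close>, because the right identity \<open>\<lambda>\<^sub>t(e)\<close> of \<open>t\<close> is one for
  \<open>s + t\<close> too, and \<open>\<lambda>\<^bsub>s + t\<^esub>(e)\<close> is the only one in \<open>e + S\<close>.
\<close>

lemma coords_add:
  assumes s: "s \<in> carrier S" and t: "t \<in> carrier S"
  shows "coords (s \<boxplus> t) = coords s \<boxplus>\<^bsub>matched_product\<^esub> coords t"
proof -
  have "s \<boxplus> t \<boxplus> lam t \<one> = s \<boxplus> t"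
    using s t by (simp add: add_assoc add_lam_one)
  then have "lam (s \<boxplus> t) \<one> = lam t \<one>"
    using s t by (simp add: add_eq_self_iff one_add_lam add_closed)
  then show ?thesis
    using s t R_part_right_zero [OF lam_one_in_R lam_one_in_R, of s t]
    by (simp add: coords_def generalized_matched_product_def add_assoc add_one_add add_closed)
qed

lemma coords_one: "coords \<one> = \<one>\<^bsub>matched_product\<^esub>"
  by (simp add: coords_def generalized_matched_product_def one_add_one lam_unit)

lemma left_semibrace_transport:
  fixes T :: "('b, 'n) semibrace_scheme"
  assumes bij: "bij_betw h (carrier S) (carrier T)"
    and mult: "\<And>x y. \<lbrakk>x \<in> carrier S; y \<in> carrier S\<rbrakk> \<Longrightarrow> h (x \<otimes> y) = h x \<otimes>\<^bsub>T\<^esub> h y"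
    and add: "\<And>x y. \<lbrakk>x \<in> carrier S; y \<in> carrier S\<rbrakk> \<Longrightarrow> h (x \<boxplus> y) = h x \<boxplus>\<^bsub>T\<^esub> h y"
    and one: "h \<one> = \<one>\<^bsub>T\<^esub>"
  shows "left_semibrace T"
proof -
  have T: "carrier T = h ` carrier S"
    using bij by (simp add: bij_betw_def)
  interpret T: group T
  proof (rule groupI)
    show "\<exists>y\<in>carrier T. y \<otimes>\<^bsub>T\<^esub> x = \<one>\<^bsub>T\<^esub>" if "x \<in> carrier T" for x
    proof -
      from that obtain u where u: "u \<in> carrier S" "x = h u" by (auto simp: T)
      then have "h (inv u) \<otimes>\<^bsub>T\<^esub> x = \<one>\<^bsub>T\<^esub>"
        by (simp add: one flip: mult)
      with u show ?thesis by (auto simp: T)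
    qed
  qed (auto simp: T m_assoc mult [symmetric] one [symmetric])
  have inv: "inv\<^bsub>T\<^esub> h x = h (inv x)" if "x \<in> carrier S" for x
    using that by (intro T.inv_equality) (auto simp: T mult [symmetric] one)
  show ?thesis
  proof unfold_locales
    fix x y z assume "x \<in> carrier T" "y \<in> carrier T" "z \<in> carrier T"
    then obtain u v w where "x = h u" "y = h v" "z = h w"
      and "u \<in> carrier S" "v \<in> carrier S" "w \<in> carrier S"
      by (auto simp: T)
    then show "x \<otimes>\<^bsub>T\<^esub> (y \<boxplus>\<^bsub>T\<^esub> z) = x \<otimes>\<^bsub>T\<^esub> y \<boxplus>\<^bsub>T\<^esub> x \<otimes>\<^bsub>T\<^esub> (inv\<^bsub>T\<^esub> x \<boxplus>\<^bsub>T\<^esub> z)"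
      using mult_add [of u v w]
      by (simp add: inv add_closed mult [symmetric] add [symmetric])
  qed (auto simp: T add_closed add_assoc add [symmetric])
qed

lemma carrier_matched_product:
  "carrier matched_product = carrier (K_part S) \<times> carrier (R_part S)"
  by (simp add: generalized_matched_product_def)

lemma left_semibrace_matched_product: "left_semibrace matched_product"
  using coords_bij coords_mult coords_add coords_one
  by (intro left_semibrace_transport [of coords]) (simp_all add: carrier_matched_product)

lemma semibrace_isomorphic_matched_product: "semibrace_isomorphic S matched_product"
proof -
  have "coords \<in> iso S matched_product"
    using coords_bij coords_mult
    by (auto simp: iso_def hom_def carrier_matched_product bij_betw_def)
  then have "coords \<in> semibrace_iso S matched_product"
    by (simp add: semibrace_iso_def coords_add)
  then show ?thesis
    by (auto simp: semibrace_isomorphic_def)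
qed

end

theorem theorem5p3:
  fixes S :: "('a, 'm) semibrace_scheme"
  assumes "left_semibrace S"
  shows "left_semibrace (K_part S) \<and> left_semibrace (R_part S) \<and>
    (\<forall>a\<in>carrier (K_part S). \<forall>x\<in>carrier (R_part S).
      delta S a x \<in> carrier (R_part S) \<and> sigma S x a \<in> carrier (K_part S)) \<and>
    generalized_matched_pair (K_part S) (R_part S) (delta S) (sigma S) \<and>
    left_semibrace (generalized_matched_product (K_part S) (R_part S) (delta S) (sigma S)) \<and>
    semibrace_isomorphic S
      (generalized_matched_product (K_part S) (R_part S) (delta S) (sigma S))"
proof -
  interpret left_semibrace S by fact
  show ?thesis
    using left_semibrace_K_part left_semibrace_R_part generalized_matched_pair_parts
      left_semibrace_matched_product semibrace_isomorphic_matched_product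
    by (simp add: delta_in_R sigma_in_K K_part_closed)
qed

end
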